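(* Let $\mathcal{A},\mathcal{B}$ be any two unital $C^*$-subalgebras of $\mathbb{M}_2(\mathbb{C})$ with $\mathbb{C}\mathbb{I}_2\subsetneq\mathcal{A}\subsetneq\mathbb{M}_2(\mathbb{C})$ and $\mathbb{C}\mathbb{I}_2\subsetneq\mathcal{B}\subsetneq\mathbb{M}_2(\mathbb{C})$. Then $$\mathrm{d}_{\mathrm{KK}}(\mathcal{A},\mathcal{B})=\sin\alpha(\mathcal{A},\mathcal{B}).$$
   Context: Kadison--Kastler distance: for subspaces $\mathcal{Y},\mathcal{Z}$ of a normed space (here $\mathbb{M}_2(\mathbb{C})$ with the operator norm), with closed unit balls $(\mathcal{Y})_1,(\mathcal{Z})_1$ and $d(x,S)=\inf\{\|x-s\|:s\in S\}$, $$\mathrm{d}_{\mathrm{KK}}(\mathcal{Y},\mathcal{Z})=\max\Big\{\sup_{y\in(\mathcal{Y})_1}d(y,(\mathcal{Z})_1),\ \sup_{z\in(\mathcal{Z})_1}d(z,(\mathcal{Y})_1)\Big\}.$$ Interior angle (taken with respect to $E_0(X)=\frac1n\operatorname{Tr}(X)\mathbb{I}_n$; here $n=2$): view $\mathbb{M}_n(\mathbb{C})$ as a Hilbert space with inner product $\langle X,Y\rangle_\tau=\frac1n\operatorname{Tr}(X^*Y)$, and let $\mathbb{M}_n(\mathbb{C})$ act on it by left multiplication. For a unital $C^*$-subalgebra $\mathcal{C}\subseteq\mathbb{M}_n(\mathbb{C})$ let $e_{\mathcal{C}}\in\mathcal{B}(\mathbb{M}_n(\mathbb{C}))$ be the Jones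 projection $X\mapsto E_{\mathcal{C}}(X)$, where $E_{\mathcal{C}}$ is the trace-preserving conditional expectation onto $\mathcal{C}$ (equivalently, $e_{\mathcal{C}}$ is the orthogonal projection onto $\mathcal{C}$), and let $e_1:=e_{\mathbb{C}\mathbb{I}_n}$. Let $\tilde{E}:\mathcal{B}(\mathbb{M}_n(\mathbb{C}))\to\mathbb{M}_n(\mathbb{C})$ be the dual conditional expectation, i.e. the linear map determined by $\tilde{E}(xe_1y)=\frac1{n^2}xy$ for $x,y\in\mathbb{M}_n(\mathbb{C})$. (Identifying $A\otimes B$ with the operator $X\mapsto AXB^T$, one has $\tilde{E}(A\otimes B)=\frac1n\operatorname{Tr}(B)A$.) For $S,T\in\mathcal{B}(\mathbb{M}_n(\mathbb{C}))$ put $\langle S,T\rangle:=\tilde{E}(S^*T)\in\mathbb{M}_n(\mathbb{C})$ and $\|S\|_{\sim}:=\|\tilde{E}(S^*S)\|^{1/2}$, where $\|\cdot\|$ is the operator norm on $\mathbb{M}_n(\mathbb{C})$. For unital $C^*$-subalgebras $\mathcal{C},\mathcal{D}\neq\mathbb{C}\mathbb{I}_n$, $\alpha(\mathcal{C},\mathcal{D})$ is the unique element of $[0,\pi/2]$ with $$\cos\alpha(\mathcal{C},\mathcal{D})=\frac{\|\langle e_{\mathcal{C}}-e_1,\,e_{\mathcal{D}}-e_1\rangle\|}{\|e_{\mathcal{C}}-e_1\|_{\sim}\,\|e_{\mathcal{D}}-e_1\|_{\sim}}.$$ *)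

theory Defs
  imports "HOL-Analysis.Analysis"
begin

text \<open>The library scalar multiplication \<open>*s\<close> on vectors does not provide complex scalar multiples of
  matrices, and the library norm on \<open>complex^'n^'n\<close> is the Frobenius norm; both the scalar action
  and the operator norm are therefore introduced separately.\<close>

definition mscale :: "complex \<Rightarrow> complex^'n^'n \<Rightarrow> complex^'n^'n" where
  "mscale c X = (\<chi> i j. c * X $ i $ j)"

definition mstar :: "complex^'n^'n \<Rightarrow> complex^'n^'n" where
  "mstar X = (\<chi> i j. cnj (X $ j $ i))"

definition opnorm :: "complex^'n^'n \<Rightarrow> real" where
  "opnorm X = onorm (\<lambda>v. X *v v)"

definition msubspace :: "(complex^'n^'n) set \<Rightarrow> bool" where
  "msubspace C \<longleftrightarrow>
     0 \<in> C \<and> (\<forall>X\<in>C. \<forall>Y\<in>C. X + Y \<in> C) \<and> (\<forall>c. \<forall>X\<in>C. mscale c X \<in> C)"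

definition unital_cstar_subalgebra :: "(complex^'n^'n) set \<Rightarrow> bool" where
  "unital_cstar_subalgebra C \<longleftrightarrow>
     msubspace C \<and> mat 1 \<in> C \<and> (\<forall>X\<in>C. \<forall>Y\<in>C. X ** Y \<in> C) \<and> (\<forall>X\<in>C. mstar X \<in> C) \<and> closed C"

definition scalar_matrices :: "(complex^'n^'n) set" where
  "scalar_matrices = range mat"

definition unit_ball :: "(complex^'n^'n) set \<Rightarrow> (complex^'n^'n) set" where
  "unit_ball Y = {y \<in> Y. opnorm y \<le> 1}"

definition dist_to_set :: "complex^'n^'n \<Rightarrow> (complex^'n^'n) set \<Rightarrow> real" where
  "dist_to_set x S = (INF s\<in>S. opnorm (x - s))"

definition dKK :: "(complex^'n^'n) set \<Rightarrow> (complex^'n^'n) set \<Rightarrow> real" where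
  "dKK Y Z = max (SUP y\<in>unit_ball Y. dist_to_set y (unit_ball Z))
                 (SUP z\<in>unit_ball Z. dist_to_set z (unit_ball Y))"

definition tau_inner :: "complex^'n^'n \<Rightarrow> complex^'n^'n \<Rightarrow> complex" where
  "tau_inner X Y = trace (mstar X ** Y) / of_nat CARD('n)"

definition clinear_op :: "(complex^'n^'n \<Rightarrow> complex^'n^'n) \<Rightarrow> bool" where
  "clinear_op S \<longleftrightarrow>
     (\<forall>X Y. S (X + Y) = S X + S Y) \<and> (\<forall>c X. S (mscale c X) = mscale c (S X))"

definition op_adjoint ::
  "(complex^'n^'n \<Rightarrow> complex^'n^'n) \<Rightarrow> complex^'n^'n \<Rightarrow> complex^'n^'n" where
  "op_adjoint S = (THE T. \<forall>X Y. tau_inner (S X) Y = tau_inner X (T Y))"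

text \<open>Positivity of the map is expressed with positive elements written as \<open>X\<^sup>* X\<close>.\<close>

definition tp_cond_exp ::
  "(complex^'n^'n) set \<Rightarrow> (complex^'n^'n \<Rightarrow> complex^'n^'n) \<Rightarrow> bool" where
  "tp_cond_exp C E \<longleftrightarrow>
     clinear_op E \<and> range E \<subseteq> C \<and> (\<forall>c\<in>C. E c = c) \<and>
     (\<forall>X. \<exists>Y. E (mstar X ** X) = mstar Y ** Y) \<and>
     (\<forall>c\<in>C. \<forall>d\<in>C. \<forall>X. E (c ** X ** d) = c ** E X ** d) \<and>
     (\<forall>X. trace (E X) = trace X)"

definition jones_proj :: "(complex^'n^'n) set \<Rightarrow> complex^'n^'n \<Rightarrow> complex^'n^'n" where
  "jones_proj C = (THE E. tp_cond_exp C E)"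

definition jones_e1 :: "complex^'n^'n \<Rightarrow> complex^'n^'n" where
  "jones_e1 = jones_proj scalar_matrices"

text \<open>A matrix acts by left multiplication. The operators on the Hilbert space are the functions
  satisfying \<open>clinear_op\<close>; the dual conditional expectation is set to \<open>0\<close> on all other
  functions, which makes it unique.\<close>

definition is_dual_cond_exp ::
  "((complex^'n^'n \<Rightarrow> complex^'n^'n) \<Rightarrow> complex^'n^'n) \<Rightarrow> bool" where
  "is_dual_cond_exp F \<longleftrightarrow>
     (\<forall>S T. clinear_op S \<longrightarrow> clinear_op T \<longrightarrow> F (\<lambda>X. S X + T X) = F S + F T) \<and>
     (\<forall>c S. clinear_op S \<longrightarrow> F (\<lambda>X. mscale c (S X)) = mscale c (F S)) \<and>
     (\<forall>x y. F ((\<lambda>X. x ** X) \<circ> jones_e1 \<circ> (\<lambda>X. y ** X)) =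
              mscale (1 / of_nat (CARD('n)\<^sup>2)) (x ** y)) \<and>
     (\<forall>S. \<not> clinear_op S \<longrightarrow> F S = 0)"

definition dual_cond_exp :: "(complex^'n^'n \<Rightarrow> complex^'n^'n) \<Rightarrow> complex^'n^'n" where
  "dual_cond_exp = (THE F. is_dual_cond_exp F)"

definition op_inner ::
  "(complex^'n^'n \<Rightarrow> complex^'n^'n) \<Rightarrow> (complex^'n^'n \<Rightarrow> complex^'n^'n) \<Rightarrow> complex^'n^'n" where
  "op_inner S T = dual_cond_exp (op_adjoint S \<circ> T)"

definition tilde_norm :: "(complex^'n^'n \<Rightarrow> complex^'n^'n) \<Rightarrow> real" where
  "tilde_norm S = sqrt (opnorm (dual_cond_exp (op_adjoint S \<circ> S)))"

definition cos_interior_angle :: "(complex^'n^'n) set \<Rightarrow> (complex^'n^'n) set \<Rightarrow> real" where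
  "cos_interior_angle C D =
     (let S = (\<lambda>X. jones_proj C X - jones_e1 X); T = (\<lambda>X. jones_proj D X - jones_e1 X)
      in opnorm (op_inner S T) / (tilde_norm S * tilde_norm T))"

definition interior_angle :: "(complex^'n^'n) set \<Rightarrow> (complex^'n^'n) set \<Rightarrow> real" where
  "interior_angle C D = (THE a. a \<in> {0..pi/2} \<and> cos a = cos_interior_angle C D)"

lemma mscale_nth [simp]: "mscale c X $ i $ j = c * X $ i $ j"
  by (simp add: mscale_def)

lemma mstar_nth [simp]: "mstar X $ i $ j = cnj (X $ j $ i)"
  by (simp add: mstar_def)

lemma trace_mscale: "trace (mscale c X) = c * trace X"
  by (simp add: trace_def sum_distrib_left)

lemma mat_eq_mscale: "mat c = mscale c (mat 1)"
  by (simp add: vec_eq_iff mat_def)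

lemma mscale_mult_left: "mscale c X ** Y = mscale c (X ** Y)"
  by (simp add: vec_eq_iff matrix_matrix_mult_def sum_distrib_left mult.assoc)

lemma mscale_mult_right: "X ** mscale c Y = mscale c (X ** Y)"
  by (simp add: vec_eq_iff matrix_matrix_mult_def sum_distrib_left mult_ac)

lemma trace_mstar_mult_self:
  "trace (mstar X ** X) = of_real (\<Sum>i\<in>UNIV. \<Sum>k\<in>UNIV. (cmod (X $ k $ i))\<^sup>2)"
  by (simp only: trace_def matrix_matrix_mult_def vec_lambda_beta mstar_nth of_real_sum
      complex_norm_square mult.commute)

lemma trace_mstar_mult_self_eq_0:
  assumes "trace (mstar X ** X) = 0"
  shows "X = 0"
proof -
  have "(\<Sum>i\<in>UNIV. \<Sum>k\<in>UNIV. (cmod (X $ k $ i))\<^sup>2) = 0"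
    using assms unfolding trace_mstar_mult_self of_real_eq_0_iff .
  then have "\<forall>i k. cmod (X $ k $ i) = 0"
    by (simp add: sum_nonneg_eq_0_iff sum_nonneg)
  then show ?thesis by (simp add: vec_eq_iff)
qed

lemma tp_cond_exp_unique:
  assumes C: "unital_cstar_subalgebra C" and E: "tp_cond_exp C E" and E': "tp_cond_exp C E'"
  shows "E = E'"
proof
  fix X
  define D where "D = E X + mscale (-1) (E' X)"
  have minus: "mscale (-1) Y = - Y" for Y :: "complex^'a^'a"
    by (simp add: vec_eq_iff)
  have one: "mat 1 \<in> C" using C by (simp add: unital_cstar_subalgebra_def)
  have "E X \<in> C" "E' X \<in> C" using E E' unfolding tp_cond_exp_def by auto
  then have "D \<in> C"
    using C unfolding D_def unital_cstar_subalgebra_def msubspace_def by simp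
  then have D: "mstar D \<in> C" using C by (simp add: unital_cstar_subalgebra_def)
  have tr: "trace (mstar D ** F X) = trace (mstar D ** X)" if F: "tp_cond_exp C F" for F
  proof -
    have "\<forall>c\<in>C. \<forall>d\<in>C. \<forall>X. F (c ** X ** d) = c ** F X ** d"
      using F unfolding tp_cond_exp_def by (elim conjE)
    from this[rule_format, OF D one, of X]
    have "F (mstar D ** X ** mat 1) = mstar D ** F X ** mat 1" .
    then have "F (mstar D ** X) = mstar D ** F X" by (simp only: matrix_mul_rid)
    moreover have "trace (F (mstar D ** X)) = trace (mstar D ** X)"
      using F unfolding tp_cond_exp_def by simp
    ultimately show ?thesis by simp
  qed
  have "mstar D ** D = mstar D ** E X + mscale (-1) (mstar D ** E' X)"
    by (subst (2) D_def) (simp only: matrix_add_ldistrib mscale_mult_right)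
  then have "trace (mstar D ** D) = 0"
    by (simp add: trace_add trace_mscale tr[OF E] tr[OF E'])
  then have "D = 0" by (rule trace_mstar_mult_self_eq_0)
  then show "E X = E' X" by (simp add: D_def minus)
qed

lemma jones_proj_eqI:
  assumes "unital_cstar_subalgebra C" and "tp_cond_exp C E"
  shows "jones_proj C = E"
  unfolding jones_proj_def
  by (rule the_equality) (rule assms(2), rule tp_cond_exp_unique[OF assms(1) _ assms(2)])

lemma scalar_matrices_eq:
  "(scalar_matrices :: (complex^'n^'n) set) = {X. \<forall>i j. X $ i $ j = (if i = j then X $ k $ k else 0)}"
  unfolding scalar_matrices_def
proof (intro set_eqI iffI)
  fix X :: "complex^'n^'n"
  assume "X \<in> {X. \<forall>i j. X $ i $ j = (if i = j then X $ k $ k else 0)}"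
  then have "X $ i $ j = mat (X $ k $ k) $ i $ j" for i j unfolding mat_def by fastforce
  then have "X = mat (X $ k $ k)" unfolding vec_eq_iff by blast
  then show "X \<in> range mat" by blast
qed (auto simp: mat_def)

lemma unital_cstar_scalar_matrices:
  "unital_cstar_subalgebra (scalar_matrices :: (complex^'n^'n) set)"
proof -
  have zero: "(0 :: complex^'n^'n) = mat 0"
    and add: "mat c + mat d = (mat (c + d) :: complex^'n^'n)"
    and scale: "mscale c (mat d) = (mat (c * d) :: complex^'n^'n)" for c d
    by (auto simp: vec_eq_iff mat_def)
  have "(0 :: complex^'n^'n) \<in> range mat" unfolding zero by (rule rangeI)
  then have "msubspace (scalar_matrices :: (complex^'n^'n) set)"
    by (auto simp: msubspace_def scalar_matrices_def add scale)
  moreover have "mat c ** mat d = (mat (c * d) :: complex^'n^'n)" for c d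
    by (simp add: mat_eq_mscale[of c] mat_eq_mscale[of d] mat_eq_mscale[of "c * d"]
        mscale_mult_left mscale_mult_right vec_eq_iff)
  then have "\<forall>X\<in>scalar_matrices. \<forall>Y\<in>scalar_matrices. X ** Y \<in> (scalar_matrices :: (complex^'n^'n) set)"
    by (auto simp: scalar_matrices_def)
  moreover have "mstar (mat c) = (mat (cnj c) :: complex^'n^'n)" for c
    by (simp add: vec_eq_iff mat_def)
  then have "\<forall>X\<in>scalar_matrices. mstar X \<in> (scalar_matrices :: (complex^'n^'n) set)"
    by (auto simp: scalar_matrices_def)
  moreover have "closed (scalar_matrices :: (complex^'n^'n) set)"
  proof -
    have "closed {X :: complex^'n^'n. X $ i $ j = (if i = j then X $ k $ k else 0)}" for i j k
      by (cases "i = j") (auto intro!: closed_Collect_eq continuous_intros)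
    then show ?thesis
      unfolding scalar_matrices_eq[of undefined] by (intro closed_Collect_all)
  qed
  ultimately show ?thesis
    by (auto simp: unital_cstar_subalgebra_def scalar_matrices_def)
qed

lemma trace_mat: "trace (mat c :: complex^'n^'n) = of_nat CARD('n) * c"
  by (simp add: trace_def mat_def)

lemma jones_e1_eq: "jones_e1 (X :: complex^'n^'n) = mat (trace X / of_nat CARD('n))"
proof -
  define E :: "complex^'n^'n \<Rightarrow> complex^'n^'n" where "E = (\<lambda>X. mat (trace X / of_nat CARD('n)))"
  have "clinear_op E"
    unfolding clinear_op_def E_def
    by (auto simp: vec_eq_iff mat_def trace_add trace_mscale add_divide_distrib)
  moreover have "range E \<subseteq> scalar_matrices"
    by (auto simp: E_def scalar_matrices_def)
  moreover have "\<forall>c\<in>scalar_matrices. E c = c"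
    by (auto simp: E_def scalar_matrices_def trace_mat)
  moreover have "\<exists>Y. E (mstar X ** X) = mstar Y ** Y" for X
  proof -
    define r where "r = (\<Sum>i\<in>UNIV. \<Sum>k\<in>UNIV. (cmod (X $ k $ i))\<^sup>2) / CARD('n)"
    have "r \<ge> 0" unfolding r_def by (intro divide_nonneg_nonneg sum_nonneg) auto
    have "mstar (mat s) = (mat s :: complex^'n^'n)" if "s = of_real t" for s t
      using that by (simp add: vec_eq_iff mat_def)
    moreover have "mat c ** mat d = (mat (c * d) :: complex^'n^'n)" for c d
      by (simp add: mat_eq_mscale[of c] mat_eq_mscale[of d] mat_eq_mscale[of "c * d"]
          mscale_mult_left mscale_mult_right vec_eq_iff)
    moreover have "E (mstar X ** X) = mat (of_real r)"
      unfolding E_def trace_mstar_mult_self r_def by simp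
    moreover have "complex_of_real r = of_real (sqrt r) * of_real (sqrt r)"
      using \<open>r \<ge> 0\<close> by (metis of_real_mult real_sqrt_mult_self abs_of_nonneg)
    ultimately show ?thesis by metis
  qed
  moreover have "E (c ** X ** d) = c ** E X ** d"
    if cd: "c \<in> scalar_matrices" "d \<in> scalar_matrices" for c d X
  proof -
    obtain a b where "c = mat a" "d = mat b"
      using cd by (auto simp: scalar_matrices_def)
    then have c: "c = mscale a (mat 1)" and d: "d = mscale b (mat 1)"
      using mat_eq_mscale by blast+
    have "c ** Y ** d = mscale (a * b) Y" for Y
      by (simp add: c d mscale_mult_left mscale_mult_right vec_eq_iff)
    moreover have "E (mscale (a * b) X) = mscale (a * b) (E X)"
      using \<open>clinear_op E\<close> by (simp add: clinear_op_def)
    ultimately show ?thesis by simp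
  qed
  moreover have "trace (E X) = trace X" for X
    by (simp add: E_def trace_mat)
  ultimately have "tp_cond_exp scalar_matrices E"
    unfolding tp_cond_exp_def by simp
  then have "jones_proj scalar_matrices = E"
    by (rule jones_proj_eqI[OF unital_cstar_scalar_matrices])
  then show ?thesis by (simp add: jones_e1_def E_def)
qed

definition munit :: "'n \<Rightarrow> 'n \<Rightarrow> complex^'n^'n" where
  "munit i j = (\<chi> k l. if k = i \<and> l = j then 1 else 0)"

lemma munit_nth [simp]: "munit i j $ k $ l = (if k = i \<and> l = j then 1 else 0)"
  by (simp add: munit_def)

lemma clinear_op_sum:
  assumes "clinear_op S"
  shows "S (\<Sum>a\<in>A. f a) = (\<Sum>a\<in>A. S (f a))"
proof -
  have "S 0 = 0"
    using assms unfolding clinear_op_def by (metis add_cancel_right_left)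
  then show ?thesis
    using assms by (induction A rule: infinite_finite_induct) (auto simp: clinear_op_def)
qed

lemma matrix_eq_sum_munit: "X = (\<Sum>i\<in>UNIV. \<Sum>j\<in>UNIV. mscale (X $ i $ j) (munit i j))"
proof -
  have "(\<Sum>i\<in>UNIV. \<Sum>j\<in>UNIV. X $ i $ j * (if k = i \<and> l = j then 1 else 0)) = X $ k $ l" for k l
  proof -
    have "(\<Sum>i\<in>UNIV. \<Sum>j\<in>UNIV. X $ i $ j * (if k = i \<and> l = j then 1 else 0)) =
          (\<Sum>i\<in>UNIV. if k = i then (\<Sum>j\<in>UNIV. if l = j then X $ i $ j else 0) else 0)"
      by (intro sum.cong refl) (auto simp: mult_delta_right)
    then show ?thesis by simp
  qed
  then show ?thesis by (simp add: vec_eq_iff)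
qed

lemma clinear_op_expand:
  assumes "clinear_op S"
  shows "S X = (\<Sum>i\<in>UNIV. \<Sum>j\<in>UNIV. mscale (X $ i $ j) (S (munit i j)))"
proof -
  have "S X = S (\<Sum>i\<in>UNIV. \<Sum>j\<in>UNIV. mscale (X $ i $ j) (munit i j))"
    using matrix_eq_sum_munit[of X] by simp
  also have "\<dots> = (\<Sum>i\<in>UNIV. \<Sum>j\<in>UNIV. mscale (X $ i $ j) (S (munit i j)))"
    using assms by (simp add: clinear_op_sum) (simp add: clinear_op_def)
  finally show ?thesis .
qed

lemma trace_mstar_mult: "trace (mstar X ** Y) = (\<Sum>i\<in>UNIV. \<Sum>j\<in>UNIV. cnj (X $ i $ j) * Y $ i $ j)"
  unfolding trace_def matrix_matrix_mult_def by simp (rule sum.swap)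

lemma tau_inner_eqD:
  assumes "\<And>X. tau_inner X Y = tau_inner X Z"
  shows "Y = Z"
proof -
  have "tau_inner (Y - Z) Y - tau_inner (Y - Z) Z = 0" using assms by simp
  then have "trace (mstar (Y - Z) ** (Y - Z)) = 0"
    by (simp add: tau_inner_def trace_mstar_mult sum_subtractf right_diff_distrib
        flip: diff_divide_distrib)
  then have "Y - Z = 0" by (rule trace_mstar_mult_self_eq_0)
  then show ?thesis by simp
qed

lemma op_adjoint_tau_inner:
  assumes S: "clinear_op S"
  shows "tau_inner (S X) Y = tau_inner X (op_adjoint S Y)"
proof -
  define T where "T = (\<lambda>Y. \<chi> i j. trace (mstar (S (munit i j)) ** Y))"
  have T: "tau_inner (S X) Y = tau_inner X (T Y)" for X Y
  proof -
    have "mstar (S X) ** Y =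
        (\<Sum>i\<in>UNIV. \<Sum>j\<in>UNIV. mscale (cnj (X $ i $ j)) (mstar (S (munit i j)) ** Y))"
      unfolding clinear_op_expand[OF S, of X]
      by (simp add: vec_eq_iff matrix_matrix_mult_def sum_distrib_left sum_distrib_right mult_ac)
         (intro allI, subst sum.swap, rule sum.cong[OF refl], rule sum.swap)
    moreover have "trace (\<Sum>a\<in>A. f a) = (\<Sum>a\<in>A. trace (f a))"
      for A :: "'a set" and f :: "'a \<Rightarrow> complex^'a^'a"
      unfolding trace_def by simp (rule sum.swap)
    ultimately show ?thesis
      by (simp add: tau_inner_def trace_mstar_mult[of X] T_def trace_mscale)
  qed
  have "op_adjoint S = T"
    unfolding op_adjoint_def
  proof (rule the_equality)
    fix T' assume *: "\<forall>X Y. tau_inner (S X) Y = tau_inner X (T' Y)"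
    show "T' = T"
    proof
      fix Y show "T' Y = T Y" by (rule tau_inner_eqD) (simp flip: * T)
    qed
  qed (use T in blast)
  then show ?thesis using T by simp
qed

definition e1_op :: "complex^'n^'n \<Rightarrow> complex^'n^'n \<Rightarrow> complex^'n^'n \<Rightarrow> complex^'n^'n" where
  "e1_op x y = (\<lambda>X. x ** X) \<circ> jones_e1 \<circ> (\<lambda>X. y ** X)"

lemma e1_op_eq: "e1_op x y X = mscale (trace (y ** X) / of_nat CARD('n)) (x :: complex^'n^'n)"
  by (simp add: e1_op_def jones_e1_eq mat_eq_mscale[of "_ / _"] mscale_mult_right)

lemma clinear_op_e1_op: "clinear_op (e1_op x y)"
  unfolding clinear_op_def e1_op_eq
  by (auto simp: vec_eq_iff matrix_add_ldistrib trace_add mscale_mult_right trace_mscale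
      add_divide_distrib distrib_right)

lemma trace_mult_munit: "trace (y ** munit l j) = y $ j $ l"
proof -
  have "(y ** munit l j) $ i $ i = (if i = j then y $ i $ l else 0)" for i
    by (cases "i = j") (simp_all add: matrix_matrix_mult_def mult_delta_right)
  then show ?thesis by (simp add: trace_def)
qed

lemma trace_munit_mult: "trace (munit l j ** y) = y $ j $ l"
  by (subst trace_mul_sym) (rule trace_mult_munit)

lemma clinear_op_lsum:
  fixes f :: "'a \<Rightarrow> complex^'n^'n \<Rightarrow> complex^'n^'n"
  assumes "\<And>a. a \<in> A \<Longrightarrow> clinear_op (f a)"
  shows "clinear_op (\<lambda>X. \<Sum>a\<in>A. f a X)"
proof -
  have "mscale c (\<Sum>a\<in>A. g a) = (\<Sum>a\<in>A. mscale c (g a))" 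
    for c and g :: "'a \<Rightarrow> complex^'n^'n"
    by (simp add: vec_eq_iff sum_distrib_left)
  then show ?thesis using assms by (simp add: clinear_op_def sum.distrib)
qed

lemma is_dual_cond_exp_sum:
  fixes F :: "(complex^'n^'n \<Rightarrow> complex^'n^'n) \<Rightarrow> complex^'n^'n"
  assumes F: "is_dual_cond_exp F" and "finite A" and "\<And>a. a \<in> A \<Longrightarrow> clinear_op (f a)"
  shows "F (\<lambda>X. \<Sum>a\<in>A. f a X) = (\<Sum>a\<in>A. F (f a))"
  using assms(2,3)
proof (induction A)
  case empty
  have z: "mscale 0 Y = 0" for Y :: "complex^'n^'n" by (simp add: vec_eq_iff)
  have "F (\<lambda>X. mscale 0 (e1_op 0 0 X)) = mscale 0 (F (e1_op 0 0))"
    using F clinear_op_e1_op unfolding is_dual_cond_exp_def by blast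
  then show ?case by (simp add: z)
next
  case (insert a A)
  have "F (\<lambda>X. f a X + (\<Sum>b\<in>A. f b X)) = F (f a) + F (\<lambda>X. \<Sum>b\<in>A. f b X)"
    using F insert.prems clinear_op_lsum[of A f] unfolding is_dual_cond_exp_def by simp
  then show ?case using insert by simp
qed

lemma is_dual_cond_exp_dual_cond_exp:
  "is_dual_cond_exp (dual_cond_exp :: (complex^'n^'n \<Rightarrow> complex^'n^'n) \<Rightarrow> complex^'n^'n)"
proof -
  let ?n = "of_nat CARD('n) :: complex"
  define F :: "(complex^'n^'n \<Rightarrow> complex^'n^'n) \<Rightarrow> complex^'n^'n" where
    "F S = (if clinear_op S then (\<chi> k l. (\<Sum>j\<in>UNIV. S (munit l j) $ k $ j) / ?n) else 0)" for S
  have "is_dual_cond_exp F"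
    unfolding is_dual_cond_exp_def
  proof (intro conjI allI impI)
    fix S T :: "complex^'n^'n \<Rightarrow> complex^'n^'n"
    assume ST: "clinear_op S" "clinear_op T"
    then have "clinear_op (\<lambda>X. S X + T X)"
      by (auto simp: clinear_op_def vec_eq_iff distrib_left)
    then show "F (\<lambda>X. S X + T X) = F S + F T"
      using ST by (simp add: F_def vec_eq_iff sum.distrib add_divide_distrib)
  next
    fix c and S :: "complex^'n^'n \<Rightarrow> complex^'n^'n"
    assume S: "clinear_op S"
    then have "clinear_op (\<lambda>X. mscale c (S X))"
      by (auto simp: clinear_op_def vec_eq_iff distrib_left)
    then show "F (\<lambda>X. mscale c (S X)) = mscale c (F S)"
      using S by (simp add: F_def vec_eq_iff sum_distrib_left)
  next
    fix x y :: "complex^'n^'n"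
    have xy: "(x ** y) $ k $ l = (\<Sum>j\<in>UNIV. x $ k $ j * y $ j $ l)" for k l
      by (simp add: matrix_matrix_mult_def)
    show "F ((\<lambda>X. x ** X) \<circ> jones_e1 \<circ> (\<lambda>X. y ** X)) =
        mscale (1 / of_nat (CARD('n)\<^sup>2)) (x ** y)"
      unfolding e1_op_def[symmetric]
      by (simp add: F_def clinear_op_e1_op e1_op_eq vec_eq_iff trace_mult_munit
          xy power2_eq_square sum_divide_distrib sum_distrib_left mult_ac)
  qed (simp add: F_def)
  moreover have "G = H" if G: "is_dual_cond_exp G" and H: "is_dual_cond_exp H"
    for G H :: "(complex^'n^'n \<Rightarrow> complex^'n^'n) \<Rightarrow> complex^'n^'n"
  proof
    fix S :: "complex^'n^'n \<Rightarrow> complex^'n^'n"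
    show "G S = H S"
    proof (cases "clinear_op S")
      case True
      define f where "f i j = e1_op (mscale ?n (S (munit i j))) (munit j i)" for i j
      have f: "clinear_op (f i j)" for i j by (simp add: f_def clinear_op_e1_op)
      have S: "S = (\<lambda>X. \<Sum>i\<in>UNIV. \<Sum>j\<in>UNIV. f i j X)"
      proof
        fix X
        have "f i j X = mscale (X $ i $ j) (S (munit i j))" for i j
          by (simp add: f_def e1_op_eq trace_munit_mult vec_eq_iff)
        then show "S X = (\<Sum>i\<in>UNIV. \<Sum>j\<in>UNIV. f i j X)"
          using clinear_op_expand[OF True, of X] by simp
      qed
      have val: "K S = (\<Sum>i\<in>UNIV. \<Sum>j\<in>UNIV.
          mscale (1 / of_nat (CARD('n)\<^sup>2)) (mscale ?n (S (munit i j)) ** munit j i))"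
        if K: "is_dual_cond_exp K" for K :: "(complex^'n^'n \<Rightarrow> complex^'n^'n) \<Rightarrow> complex^'n^'n"
      proof -
        have "K S = (\<Sum>i\<in>UNIV. \<Sum>j\<in>UNIV. K (f i j))"
          by (subst S) (simp add: is_dual_cond_exp_sum[OF K] clinear_op_lsum f)
        moreover have "K (f i j) =
            mscale (1 / of_nat (CARD('n)\<^sup>2)) (mscale ?n (S (munit i j)) ** munit j i)" for i j
          using K unfolding is_dual_cond_exp_def f_def e1_op_def by simp
        ultimately show ?thesis by simp
      qed
      show ?thesis unfolding val[OF G] val[OF H] ..
    next
      case False
      then show ?thesis using G H by (simp add: is_dual_cond_exp_def)
    qed
  qed
  ultimately show ?thesis
    unfolding dual_cond_exp_def by (metis theI')
qed

end

theory Submission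
  imports Defs
begin

text \<open>A proper unital \<open>C\<^sup>*\<close>-subalgebra containing non-scalar matrices is the span of the identity and
  \<open>U = a \<cdot> \<sigma>\<close>, where \<open>\<sigma>\<close> are the Pauli matrices and \<open>a\<close> is a unit vector of
  \<open>\<real>\<^sup>3\<close>: the self-adjoint traceless part of the algebra is a real subspace of \<open>\<real>\<^sup>3\<close> closed under
  the cross product, and such a subspace containing two independent vectors is everything.
  Write \<open>V = b \<cdot> \<sigma>\<close> for the second algebra. Then \<open>e\<^sub>A - e\<^sub>1 = U e\<^sub>1 U\<close>, and the product of
  \<open>U e\<^sub>1 U\<close> and \<open>V e\<^sub>1 V\<close> is \<open>(a \<bullet> b) U e\<^sub>1 V\<close>, so that the cosine of the angle is
  \<open>\<bar>a \<bullet> b\<bar>\<close>. On the other side, \<open>t + w U\<close> lies within \<open>\<parallel>a - (a \<bullet> b) b\<parallel>\<close> of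
  \<open>t + w (a \<bullet> b) V\<close>, and comparison of the operator norm with the normalised Frobenius norm shows
  that \<open>U\<close> is not closer than that to the second algebra.\<close>

unbundle cross3_syntax

section \<open>Scalar multiples and the operator norm\<close>

lemma mscale_mscale [simp]: "mscale c (mscale d X) = mscale (c * d) X"
  by (simp add: vec_eq_iff)

lemma mscale_add_left: "mscale (c + d) X = mscale c X + mscale d X"
  by (simp add: vec_eq_iff distrib_right)

lemma mscale_one [simp]: "mscale 1 X = X"
  by (simp add: vec_eq_iff)

lemma mscale_mult_vec: "mscale c X *v v = c *s (X *v v)"
  by (simp add: vec_eq_iff matrix_vector_mult_def sum_distrib_left mult.assoc)

lemma mult_vec_smult: "X *v (c *s v) = c *s (X *v v)" for c :: complex
  by (simp add: vec_eq_iff matrix_vector_mult_def sum_distrib_left mult_ac)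

lemma mat_mult_vec: "mat c *v v = c *s v" for c :: complex
  by (simp add: vec_eq_iff mat_def matrix_vector_mult_def if_distrib if_distribR cong: if_cong)

lemma norm_smult: "norm (c *s v) = cmod c * norm v" for v :: "complex^'n"
  by (simp add: norm_vec_def norm_mult L2_set_right_distrib)

lemma mat_mult: "mat c ** X = mscale c X" "X ** mat c = mscale c X"
  by (simp_all add: mat_eq_mscale[of c] mscale_mult_left mscale_mult_right)

lemma matrix_add_rdistrib: "(X + Y) ** Z = X ** Z + Y ** Z" for X Y Z :: "complex^'n^'n"
  by (simp add: vec_eq_iff matrix_matrix_mult_def distrib_right sum.distrib)

lemma norm_mult_vec_le: "norm (X *v v) \<le> opnorm X * norm v" for X :: "complex^'n^'n"
  unfolding opnorm_def by (rule onorm) simp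

lemma opnorm_nonneg: "0 \<le> opnorm X" for X :: "complex^'n^'n"
  unfolding opnorm_def by (rule onorm_pos_le) simp

lemma opnorm_le:
  fixes X :: "complex^'n^'n"
  assumes "\<And>v. norm (X *v v) \<le> r * norm v"
  shows "opnorm X \<le> r"
  unfolding opnorm_def using assms by (rule onorm_le)

lemma norm_axis_one: "norm (axis i 1 :: complex^'n) = 1"
  by (simp add: norm_vec_def L2_set_def axis_def if_distrib if_distribR cong: if_cong)

lemma opnorm_eqI:
  fixes X :: "complex^'n^'n"
  assumes "\<And>v. norm (X *v v) = r * norm v"
  shows "opnorm X = r"
proof (rule antisym)
  \<comment> \<open>Any basis vector gives the lower bound; the choice of index is
    immaterial.\<close>
  have "r * norm (axis undefined 1 :: complex^'n) \<le> opnorm X * norm (axis undefined 1 :: complex^'n)"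
    by (metis assms norm_mult_vec_le)
  then show "r \<le> opnorm X" by (simp add: norm_axis_one)
qed (simp add: opnorm_le assms)

section \<open>Pauli matrices, their products and their norms\<close>

definition pauli :: "real^3 \<Rightarrow> complex^2^2" where
  "pauli a = vector [vector [of_real (a$3), Complex (a$1) (- (a$2))],
                     vector [Complex (a$1) (a$2), - of_real (a$3)]]"

lemma pauli_nth [simp]:
  "pauli a $ 1 $ 1 = of_real (a$3)" "pauli a $ 1 $ 2 = Complex (a$1) (- (a$2))"
  "pauli a $ 2 $ 1 = Complex (a$1) (a$2)" "pauli a $ 2 $ 2 = - of_real (a$3)"
  by (simp_all add: pauli_def vector_2)

lemma mat_nth_2 [simp]:
  "(mat c :: complex^2^2) $ 1 $ 1 = c" "(mat c :: complex^2^2) $ 1 $ 2 = 0"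
  "(mat c :: complex^2^2) $ 2 $ 1 = 0" "(mat c :: complex^2^2) $ 2 $ 2 = c"
  by (simp_all add: mat_def)

lemma pauli_zero [simp]: "pauli 0 = 0"
  by (simp add: vec_eq_iff forall_2 complex_eq_iff)

lemma pauli_add: "pauli (a + b) = pauli a + pauli b"
  by (simp add: vec_eq_iff forall_2 complex_eq_iff)

lemma pauli_diff: "pauli (a - b) = pauli a - pauli b"
  by (simp add: vec_eq_iff forall_2 complex_eq_iff)

lemma pauli_scaleR: "pauli (r *\<^sub>R a) = mscale (of_real r) (pauli a)"
  by (simp add: vec_eq_iff forall_2 complex_eq_iff)

lemma mstar_pauli [simp]: "mstar (pauli a) = pauli a"
  by (simp add: vec_eq_iff forall_2 complex_eq_iff)

lemma trace_pauli [simp]: "trace (pauli a) = 0"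
  by (simp add: trace_def sum_2)

text \<open>The scalar part makes \<open>pauli a\<close> an involution for a unit vector
  \<open>a\<close>; the traceless part turns closure under products into closure under
  \<open>\<times>\<close>.\<close>

lemma pauli_mult: "pauli a ** pauli b = mat (of_real (a \<bullet> b)) + mscale \<i> (pauli (a \<times> b))"
  by (simp add: vec_eq_iff forall_2 matrix_matrix_mult_def sum_2 complex_eq_iff
      inner_vec_def sum_3 cross3_def)

lemma pauli_decomp: obtains t u v where "X = mat t + pauli u + mscale \<i> (pauli v)"
proof -
  \<comment> \<open>The complex Pauli coordinates solve \<open>X$1$2 = ?x - \<i> * ?y\<close> and
    \<open>X$2$1 = ?x + \<i> * ?y\<close>; \<open>u\<close> and \<open>v\<close> are their real and
    imaginary parts.\<close>
  let ?z = "(X$1$1 - X$2$2) / 2" and ?x = "(X$1$2 + X$2$1) / 2" and ?y = "\<i> * (X$1$2 - X$2$1) / 2"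
  have "X = mat ((X$1$1 + X$2$2) / 2) + pauli (vector [Re ?x, Re ?y, Re ?z])
          + mscale \<i> (pauli (vector [Im ?x, Im ?y, Im ?z]))"
    by (simp add: vec_eq_iff forall_2 complex_eq_iff field_simps)
  then show ?thesis by (rule that)
qed

text \<open>\<open>pauli a\<close> is self-adjoint and its square is the identity times the squared
  length of \<open>a\<close>, so it is \<open>norm a\<close> times a unitary.\<close>

lemma norm_pauli_mult_vec: "norm (pauli a *v v) = norm a * norm v"
proof -
  have sq: "(norm v)\<^sup>2 = (cmod (v$1))\<^sup>2 + (cmod (v$2))\<^sup>2" for v :: "complex^2"
    by (simp add: norm_vec_def L2_set_def sum_2)
  have "(norm (pauli a *v v))\<^sup>2 = (norm a * norm v)\<^sup>2"
    unfolding power_mult_distrib sq power2_norm_eq_inner[of a]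
    by (simp add: matrix_vector_mult_def sum_2 cmod_power2 inner_vec_def sum_3)
       (simp add: power2_eq_square algebra_simps)
  then show ?thesis by (simp add: power2_eq_iff_nonneg)
qed

text \<open>The identity and the Pauli matrices are orthogonal with squared Frobenius norm 2, and
  the factor \<open>\<i>\<close> separates \<open>v\<close> from \<open>u\<close>.\<close>

lemma frobenius_pauli:
  "(\<Sum>i\<in>UNIV. \<Sum>j\<in>UNIV. (cmod ((mat t + pauli u + mscale \<i> (pauli v)) $ j $ i))\<^sup>2) =
     2 * ((cmod t)\<^sup>2 + (norm u)\<^sup>2 + (norm v)\<^sup>2)"
  by (simp add: sum_2 cmod_power2 power2_norm_eq_inner inner_vec_def sum_3)
     (simp add: power2_eq_square algebra_simps)

text \<open>Each column is the image of a unit basis vector, so its length is at most the operator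
  norm.\<close>

lemma frobenius_le_opnorm:
  fixes X :: "complex^'n^'n"
  shows "(\<Sum>i\<in>UNIV. \<Sum>j\<in>UNIV. (cmod (X $ j $ i))\<^sup>2) \<le> CARD('n) * (opnorm X)\<^sup>2"
proof -
  have "(\<Sum>j\<in>UNIV. (cmod (X $ j $ i))\<^sup>2) \<le> (opnorm X)\<^sup>2" for i
  proof -
    have "(X *v axis i 1) $ j = X $ j $ i" for j
      by (simp add: matrix_vector_mult_def axis_def if_distrib cong: if_cong)
    then have "(\<Sum>j\<in>UNIV. (cmod (X $ j $ i))\<^sup>2) = (norm (X *v axis i 1))\<^sup>2"
      by (simp add: norm_vec_def L2_set_def sum_nonneg)
    also have "\<dots> \<le> (opnorm X)\<^sup>2"
      using norm_mult_vec_le[of X "axis i 1"] by (intro power_mono) (auto simp: norm_axis_one)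
    finally show ?thesis .
  qed
  then have "(\<Sum>i\<in>UNIV. \<Sum>j\<in>UNIV. (cmod (X $ j $ i))\<^sup>2) \<le> (\<Sum>i\<in>(UNIV::'n set). (opnorm X)\<^sup>2)"
    by (intro sum_mono)
  then show ?thesis by simp
qed

section \<open>Classification of the proper subalgebras\<close>

text \<open>Cramer's rule for \<open>a\<close>, \<open>w\<close>, \<open>n\<close>, whose
  determinant is \<open>n \<bullet> n\<close>, with denominators cleared. If \<open>n\<close> is
  nonzero, a subspace closed under \<open>\<times>\<close> that contains \<open>a\<close> and
  \<open>w\<close> is the whole space.\<close>

lemma cross3_expand:
  fixes a w x :: "real^3"
  defines "n \<equiv> a \<times> w"
  shows "(n \<bullet> n) *\<^sub>R x = (x \<bullet> (w \<times> n)) *\<^sub>R a + (x \<bullet> (n \<times> a)) *\<^sub>R w + (x \<bullet> n) *\<^sub>R n"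
  unfolding n_def by (simp add: cross3_simps forall_3)

text \<open>The expansion of the triple product \<open>a \<times> (a \<times> w)\<close>.\<close>

lemma cross3_parallel: "a \<times> w = 0 \<Longrightarrow> (a \<bullet> a) *\<^sub>R w = (a \<bullet> w) *\<^sub>R a" for a w :: "real^3"
proof -
  have "(a \<bullet> a) *\<^sub>R w = (a \<bullet> w) *\<^sub>R a - a \<times> (a \<times> w)"
    by (simp add: cross3_simps forall_3)
  then show "a \<times> w = 0 \<Longrightarrow> ?thesis" by simp
qed

definition pauli_algebra :: "real^3 \<Rightarrow> (complex^2^2) set" where
  "pauli_algebra a = {mat t + mscale w (pauli a) | t w. True}"

lemma proper_unital_cstar_subalgebra_eq_pauli_algebra:
  assumes A: "unital_cstar_subalgebra A" "scalar_matrices \<subset> A" "A \<subset> UNIV"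
  obtains a where "norm a = 1" and "A = pauli_algebra a"
proof -
  have add: "X + Y \<in> A" and mult: "X ** Y \<in> A" if "X \<in> A" "Y \<in> A" for X Y
    using that A(1) unfolding unital_cstar_subalgebra_def msubspace_def by auto
  have scale: "mscale c X \<in> A" and star: "mstar X \<in> A" if "X \<in> A" for X c
    using that A(1) unfolding unital_cstar_subalgebra_def msubspace_def by auto
  have mat: "mat c \<in> A" for c
    using A(2) by (auto simp: scalar_matrices_def)
  \<comment> \<open>The self-adjoint traceless elements of \<open>A\<close>, read as vectors;
    \<open>R\<close> will turn out to be a line.\<close>
  define R where "R = {a. pauli a \<in> A}"
  have R_add: "a + b \<in> R" if "a \<in> R" "b \<in> R" for a b
    using that add by (simp add: R_def pauli_add)
  have R_scale: "r *\<^sub>R a \<in> R" if "a \<in> R" for a r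
    using that scale by (simp add: R_def pauli_scaleR)
  have R_cross: "a \<times> b \<in> R" if "a \<in> R" "b \<in> R" for a b
  proof -
    have "pauli (a \<times> b) = mscale (- \<i>) (pauli a ** pauli b + mat (- of_real (a \<bullet> b)))"
      unfolding pauli_mult by (simp add: vec_eq_iff mat_def)
    then show ?thesis using that by (simp add: R_def scale add mult mat)
  qed
  have in_R: "u \<in> R" "v \<in> R" if X: "mat t + pauli u + mscale \<i> (pauli v) \<in> A" for t u v
  proof -
    let ?X = "mat t + pauli u + mscale \<i> (pauli v)"
    \<comment> \<open>Half the sum of \<open>?X\<close> and its adjoint is \<open>pauli u\<close>
      plus the scalar \<open>Re t\<close>; the difference divided by \<open>2 * \<i>\<close> yields
      \<open>pauli v\<close> plus \<open>Im t\<close>.\<close>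
    have "pauli u = mscale (1/2) (?X + mstar ?X) + mat (- of_real (Re t))"
      by (simp add: vec_eq_iff forall_2 complex_eq_iff field_simps)
    moreover have "\<dots> \<in> A"
      by (rule add scale star mat X)+
    ultimately show "u \<in> R" by (simp add: R_def)
    have "pauli v = mscale (- \<i>/2) (?X + mscale (-1) (mstar ?X)) + mat (- of_real (Im t))"
      by (simp add: vec_eq_iff forall_2 complex_eq_iff field_simps)
    moreover have "\<dots> \<in> A"
      by (rule add scale star mat X)+
    ultimately show "v \<in> R" by (simp add: R_def)
  qed
  have "\<exists>b\<in>R. b \<noteq> 0"
  proof (rule ccontr)
    assume *: "\<not> ?thesis"
    have "X \<in> scalar_matrices" if "X \<in> A" for X
    proof -
      obtain t u v where X: "X = mat t + pauli u + mscale \<i> (pauli v)" by (rule pauli_decomp)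
      then have "u = 0" "v = 0" using in_R that * by blast+
      then have "X = mat t" unfolding X by (simp add: vec_eq_iff forall_2 complex_eq_iff)
      then show ?thesis by (simp add: scalar_matrices_def)
    qed
    then show False using A(2) by blast
  qed
  then obtain b where b: "b \<in> R" "b \<noteq> 0" by blast
  define a where "a = sgn b"
  have a: "a \<in> R" "norm a = 1" using b by (simp_all add: a_def sgn_div_norm R_scale)
  have line: "w = (a \<bullet> w) *\<^sub>R a" if "w \<in> R" for w
  proof -
    have "a \<times> w = 0"
    proof (rule ccontr)
      \<comment> \<open>Independence of \<open>a\<close> and \<open>w\<close> makes \<open>R\<close>
        the whole space by \<open>cross3_expand\<close>, and then \<open>A\<close> contains every
        matrix, against properness.\<close>
      assume n: "a \<times> w \<noteq> 0"
      have "x \<in> R" for x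
      proof -
        let ?n = "a \<times> w"
        have "x = (1 / (?n \<bullet> ?n)) *\<^sub>R ((?n \<bullet> ?n) *\<^sub>R x)" using n by simp
        also have "\<dots> \<in> R" unfolding cross3_expand
          by (intro R_scale R_add R_cross a that)
        finally show ?thesis .
      qed
      then have *: "pauli x \<in> A" for x by (simp add: R_def)
      have "X \<in> A" for X
      proof -
        obtain t u v where X: "X = mat t + pauli u + mscale \<i> (pauli v)" by (rule pauli_decomp)
        show ?thesis unfolding X by (rule add scale mat *)+
      qed
      then show False using A(3) by blast
    qed
    then show ?thesis using cross3_parallel[of a w] a by (simp add: dot_square_norm)
  qed
  have "A = pauli_algebra a"
    unfolding pauli_algebra_def
  proof (intro equalityI subsetI)
    fix X assume "X \<in> A"
    obtain t u v where X: "X = mat t + pauli u + mscale \<i> (pauli v)" by (rule pauli_decomp)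
    then have "u = (a \<bullet> u) *\<^sub>R a" "v = (a \<bullet> v) *\<^sub>R a" using in_R line \<open>X \<in> A\<close> by blast+
    then have "pauli u = mscale (of_real (a \<bullet> u)) (pauli a)" "pauli v = mscale (of_real (a \<bullet> v)) (pauli a)"
      by (metis pauli_scaleR)+
    then have "X = mat t + mscale (of_real (a \<bullet> u) + \<i> * of_real (a \<bullet> v)) (pauli a)"
      by (simp add: X mscale_add_left add.assoc)
    then show "X \<in> {mat t + mscale w (pauli a) | t w. True}" by blast
  next
    fix X assume "X \<in> {mat t + mscale w (pauli a) | t w. True}"
    then show "X \<in> A" using a by (auto simp: R_def add scale mat)
  qed
  then show ?thesis using a(2) that by blast
qed

section \<open>Eigenvalues and operator norms in \<open>pauli_algebra a\<close>\<close>

lemma pauli_square: "norm a = 1 \<Longrightarrow> pauli a ** pauli a = mat 1"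
  by (simp add: pauli_mult dot_square_norm vec_eq_iff)

lemma pauli_pauli_mult_vec: "norm a = 1 \<Longrightarrow> pauli a *v (pauli a *v v) = v"
  by (simp add: matrix_vector_mul_assoc pauli_square)

text \<open>\<open>t + w\<close> is the eigenvalue on the eigenspace of \<open>pauli a\<close> for
  1, and every vector \<open>v + pauli a *v v\<close> lies in that space.\<close>

lemma cmod_add_le_opnorm_pauli:
  assumes a: "norm a = 1"
  shows "cmod (t + w) \<le> opnorm (mat t + mscale w (pauli a))"
proof -
  let ?U = "pauli a"
  \<comment> \<open>Otherwise \<open>?U\<close> would be minus the identity, but
    \<open>mat 1 + ?U\<close> has trace 2.\<close>
  obtain v where v: "v + ?U *v v \<noteq> 0"
  proof (rule ccontr)
    assume "\<not> thesis"
    then have "(mat 1 + ?U) *v v = 0 *v v" for v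
      using that by (auto simp: matrix_vector_mult_add_rdistrib)
    then have "mat 1 + ?U = 0" by (simp add: matrix_eq)
    then have "trace (mat 1 + ?U) = 0" by (simp add: trace_def)
    then show False by (simp add: trace_add trace_mat)
  qed
  let ?p = "v + ?U *v v"
  have "(mat t + mscale w ?U) *v ?p = (t + w) *s ?p"
    by (simp add: matrix_vector_mult_add_rdistrib matrix_vector_right_distrib mscale_mult_vec
        mat_mult_vec pauli_pauli_mult_vec[OF a] vector_add_ldistrib vector_sadd_rdistrib)
  then have "cmod (t + w) * norm ?p \<le> opnorm (mat t + mscale w ?U) * norm ?p"
    by (metis norm_mult_vec_le norm_smult)
  then show ?thesis using v by simp
qed

lemma cmod_diff_le_opnorm_pauli:
  assumes "norm a = 1"
  shows "cmod (t - w) \<le> opnorm (mat t + mscale w (pauli a))"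
proof -
  \<comment> \<open>Passing to \<open>- a\<close> exchanges the two eigenspaces.\<close>
  have "mat t + mscale w (pauli a) = mat t + mscale (- w) (pauli (- a))"
    by (simp add: vec_eq_iff forall_2 complex_eq_iff)
  then show ?thesis
    using cmod_add_le_opnorm_pauli[of "- a" t "- w"] assms by simp
qed

text \<open>Split \<open>v\<close> into eigenvectors \<open>p\<close> and \<open>q\<close> of
  \<open>pauli a\<close> for 1 and -1. Since \<open>pauli a\<close> preserves norms,
  \<open>p + q\<close> and \<open>p - q\<close> have equal norm, and the parallelogram law yields
  the Pythagorean identity for \<open>p\<close> and \<open>q\<close>.\<close>

lemma opnorm_pauli_le:
  assumes a: "norm a = 1" and "cmod (t + w) \<le> r" and "cmod (t - w) \<le> r"
  shows "opnorm (mat t + mscale w (pauli a)) \<le> r"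
proof (rule opnorm_le)
  fix v :: "complex^2"
  let ?U = "pauli a"
  define p q where "p = (1/2) *s (v + ?U *v v)" and "q = (1/2) *s (v - ?U *v v)"
  have par: "(norm (x + y))\<^sup>2 + (norm (x - y))\<^sup>2 = 2 * ((norm x)\<^sup>2 + (norm y)\<^sup>2)" for x y :: "complex^2"
    by (simp add: power2_norm_eq_inner inner_simps inner_commute)
  have Up: "?U *v p = p" and Uq: "?U *v q = - q"
    by (simp_all add: p_def q_def mult_vec_smult matrix_vector_right_distrib
        matrix_vector_mult_diff_distrib pauli_pauli_mult_vec[OF a] vec_eq_iff)
  have v: "v = p + q" and Uv: "?U *v v = p - q"
    by (simp_all add: p_def q_def vec_eq_iff field_simps)
  have pq: "(norm p)\<^sup>2 + (norm q)\<^sup>2 = (norm v)\<^sup>2"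
    using par[of p q] norm_pauli_mult_vec[of a v] a unfolding v[symmetric] Uv[symmetric] by simp
  define y where "y = (t + w) *s p + (t - w) *s q"
  have y: "(mat t + mscale w ?U) *v v = y"
    unfolding matrix_vector_mult_add_rdistrib mscale_mult_vec mat_mult_vec Uv
    by (simp add: v y_def vec_eq_iff algebra_simps)
  \<comment> \<open>The same parallelogram argument applies to the eigencomponents of
    \<open>y\<close>.\<close>
  have "?U *v y = (t + w) *s p - (t - w) *s q"
    unfolding y_def matrix_vector_right_distrib mult_vec_smult Up Uq vector_smult_rneg by simp
  then have "2 * (norm y)\<^sup>2 = 2 * ((norm ((t + w) *s p))\<^sup>2 + (norm ((t - w) *s q))\<^sup>2)"
    using par[of "(t + w) *s p" "(t - w) *s q"] norm_pauli_mult_vec[of a y] a by (simp add: y_def)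
  then have "(norm y)\<^sup>2 = (cmod (t + w))\<^sup>2 * (norm p)\<^sup>2 + (cmod (t - w))\<^sup>2 * (norm q)\<^sup>2"
    unfolding norm_smult power_mult_distrib by simp
  also have "\<dots> \<le> r\<^sup>2 * (norm p)\<^sup>2 + r\<^sup>2 * (norm q)\<^sup>2"
    using assms by (intro add_mono mult_right_mono power_mono) auto
  also have "\<dots> = (r * norm v)\<^sup>2"
    by (simp add: pq[symmetric] power_mult_distrib distrib_left)
  finally have "norm y \<le> r * norm v"
    by (rule power2_le_imp_le) (use order_trans[OF norm_ge_zero assms(2)] in simp)
  then show "norm ((mat t + mscale w ?U) *v v) \<le> r * norm v" by (simp only: y)
qed

lemma opnorm_mscale_pauli: "opnorm (mscale w (pauli a)) = cmod w * norm a"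
  by (rule opnorm_eqI) (simp add: mscale_mult_vec norm_smult norm_pauli_mult_vec)

section \<open>The Kadison--Kastler distance\<close>

text \<open>Pythagoras: \<open>(a \<bullet> b) *\<^sub>R b\<close> is the foot of the perpendicular
  from \<open>a\<close> to the line through \<open>b\<close>.\<close>

lemma norm_diff_inner_scaleR:
  assumes "norm a = 1" "norm b = 1"
  shows "(norm (a - r *\<^sub>R b))\<^sup>2 = 1 - (a \<bullet> b)\<^sup>2 + (r - a \<bullet> b)\<^sup>2"
proof -
  have "a \<bullet> a = 1" "b \<bullet> b = 1" using assms by (simp_all add: dot_square_norm)
  then show ?thesis
    by (simp add: power2_norm_eq_inner inner_simps inner_commute)
       (simp add: power2_eq_square algebra_simps)
qed

lemma abs_inner_unit_le_one: "norm a = 1 \<Longrightarrow> norm b = 1 \<Longrightarrow> \<bar>a \<bullet> b\<bar> \<le> 1"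
  using Cauchy_Schwarz_ineq2[of a b] by simp

lemma dist_to_set_le: "s \<in> S \<Longrightarrow> dist_to_set X S \<le> opnorm (X - s)" for X :: "complex^'n^'n"
  unfolding dist_to_set_def
  by (rule cINF_lower) (auto intro!: bdd_belowI2[where m = 0] opnorm_nonneg)

lemma pauli_in_unit_ball: "norm a = 1 \<Longrightarrow> pauli a \<in> unit_ball (pauli_algebra a)"
proof -
  assume "norm a = 1"
  then have "opnorm (pauli a) \<le> 1" using opnorm_mscale_pauli[of 1 a] by simp
  moreover have "pauli a = mat 0 + mscale 1 (pauli a)" by (simp add: vec_eq_iff mat_def)
  ultimately show ?thesis unfolding unit_ball_def pauli_algebra_def by blast
qed

lemma dist_to_unit_ball_le:
  assumes a: "norm a = 1" and b: "norm b = 1" and y: "y \<in> unit_ball (pauli_algebra a)"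
  shows "dist_to_set y (unit_ball (pauli_algebra b)) \<le> sqrt (1 - (a \<bullet> b)\<^sup>2)"
proof -
  obtain t w where y_eq: "y = mat t + mscale w (pauli a)" and "opnorm y \<le> 1"
    using y by (auto simp: unit_ball_def pauli_algebra_def)
  then have le1: "cmod (t + w) \<le> 1" "cmod (t - w) \<le> 1"
    using cmod_add_le_opnorm_pauli[OF a, of t w] cmod_diff_le_opnorm_pauli[OF a, of t w] by auto
  define c where "c = a \<bullet> b"
  have c: "\<bar>c\<bar> \<le> 1" unfolding c_def using a b by (rule abs_inner_unit_le_one)
  \<comment> \<open>\<open>t + r w\<close> is a convex combination of the eigenvalues
    \<open>t + w\<close> and \<open>t - w\<close> of \<open>y\<close>.\<close>
  have conv: "cmod (t + of_real r * w) \<le> 1" if "\<bar>r\<bar> \<le> 1" for r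
  proof -
    have "t + of_real r * w = of_real ((1 + r) / 2) * (t + w) + of_real ((1 - r) / 2) * (t - w)"
      by (simp add: field_simps)
    also have "cmod \<dots> \<le> cmod (of_real ((1 + r) / 2) * (t + w)) + cmod (of_real ((1 - r) / 2) * (t - w))"
      by (rule norm_triangle_ineq)
    also have "\<dots> = ((1 + r) / 2) * cmod (t + w) + ((1 - r) / 2) * cmod (t - w)"
      using that unfolding norm_mult norm_of_real by simp
    also have "\<dots> \<le> ((1 + r) / 2) * 1 + ((1 - r) / 2) * 1"
      using that le1 by (intro add_mono mult_left_mono) auto
    finally show ?thesis by (simp add: field_simps)
  qed
  \<comment> \<open>The orthogonal projection of \<open>y\<close> to the second algebra; its
    eigenvalues \<open>t + c w\<close> and \<open>t - c w\<close> stay in the unit disc by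
    \<open>conv\<close>.\<close>
  define z where "z = mat t + mscale (of_real c * w) (pauli b)"
  have "opnorm z \<le> 1"
    unfolding z_def using conv[of c] conv[of "- c"] c by (intro opnorm_pauli_le b) auto
  then have "z \<in> unit_ball (pauli_algebra b)"
    by (auto simp: unit_ball_def pauli_algebra_def z_def)
  then have "dist_to_set y (unit_ball (pauli_algebra b)) \<le> opnorm (y - z)"
    by (rule dist_to_set_le)
  also have "y - z = mscale w (pauli (a - c *\<^sub>R b))"
    by (simp add: y_eq z_def pauli_diff pauli_scaleR vec_eq_iff algebra_simps)
  also have "opnorm \<dots> = cmod w * norm (a - c *\<^sub>R b)" by (rule opnorm_mscale_pauli)
  also have "norm (a - c *\<^sub>R b) = sqrt (1 - (a \<bullet> b)\<^sup>2)"
    using norm_diff_inner_scaleR[OF a b, of c] by (simp add: c_def real_sqrt_unique)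
  also have "cmod w * \<dots> \<le> 1 * \<dots>"
  proof (rule mult_right_mono)
    \<comment> \<open>Two eigenvalues in the unit disc differ by at most 2.\<close>
    have "(t + w) - (t - w) = 2 * w" by simp
    then have "2 * cmod w = cmod ((t + w) - (t - w))" by (simp add: norm_mult)
    also have "\<dots> \<le> 2" using norm_triangle_ineq4[of "t + w" "t - w"] le1 by linarith
    finally show "cmod w \<le> 1" by simp
    show "0 \<le> sqrt (1 - (a \<bullet> b)\<^sup>2)"
      using c by (simp add: c_def abs_square_le_1)
  qed
  finally show ?thesis by simp
qed

lemma dist_pauli_to_unit_ball_ge:
  assumes a: "norm a = 1" and b: "norm b = 1"
  shows "sqrt (1 - (a \<bullet> b)\<^sup>2) \<le> dist_to_set (pauli a) (unit_ball (pauli_algebra b))"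
  unfolding dist_to_set_def
proof (rule cINF_greatest)
  fix z assume "z \<in> unit_ball (pauli_algebra b)"
  then obtain t w where z: "z = mat t + mscale w (pauli b)"
    by (auto simp: unit_ball_def pauli_algebra_def)
  have eq: "pauli a - z = mat (- t) + pauli (a - Re w *\<^sub>R b) + mscale \<i> (pauli (- Im w *\<^sub>R b))"
    by (simp add: z vec_eq_iff forall_2 complex_eq_iff algebra_simps)
  \<comment> \<open>The real Pauli part alone is at least as long as the perpendicular from
    \<open>a\<close> to the line of \<open>b\<close>; the other two terms are nonnegative.\<close>
  have "1 - (a \<bullet> b)\<^sup>2 \<le> (cmod (- t))\<^sup>2 + (norm (a - Re w *\<^sub>R b))\<^sup>2 + (norm (- Im w *\<^sub>R b))\<^sup>2"
    unfolding norm_diff_inner_scaleR[OF a b] by simp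
  also have "\<dots> \<le> (opnorm (pauli a - z))\<^sup>2"
    using frobenius_le_opnorm[of "pauli a - z"] unfolding eq frobenius_pauli by simp
  finally show "sqrt (1 - (a \<bullet> b)\<^sup>2) \<le> opnorm (pauli a - z)"
    by (rule real_le_lsqrt[rotated]) (rule opnorm_nonneg)
qed (use pauli_in_unit_ball[OF b] in blast)

text \<open>The upper and lower bounds meet at \<open>pauli a\<close>, so the supremum is a
  maximum.\<close>

lemma SUP_dist_to_unit_ball:
  assumes a: "norm a = 1" and b: "norm b = 1"
  shows "(SUP y\<in>unit_ball (pauli_algebra a). dist_to_set y (unit_ball (pauli_algebra b)))
           = sqrt (1 - (a \<bullet> b)\<^sup>2)"
proof (rule cSup_eq_maximum)
  have "dist_to_set (pauli a) (unit_ball (pauli_algebra b)) = sqrt (1 - (a \<bullet> b)\<^sup>2)"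
    by (intro antisym dist_to_unit_ball_le dist_pauli_to_unit_ball_ge pauli_in_unit_ball a b)
  then show "sqrt (1 - (a \<bullet> b)\<^sup>2) \<in> (\<lambda>y. dist_to_set y (unit_ball (pauli_algebra b))) ` unit_ball (pauli_algebra a)"
    using pauli_in_unit_ball[OF a] by (metis image_eqI)
qed (use dist_to_unit_ball_le[OF a b] in blast)

lemma dKK_pauli_algebra:
  assumes a: "norm a = 1" and b: "norm b = 1"
  shows "dKK (pauli_algebra a) (pauli_algebra b) = sqrt (1 - (a \<bullet> b)\<^sup>2)"
  by (simp add: dKK_def SUP_dist_to_unit_ball a b inner_commute)

section \<open>The conditional expectation onto \<open>pauli_algebra a\<close>\<close>

text \<open>For a unit vector \<open>a\<close> the matrices \<open>mat 1\<close> and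
  \<open>pauli a\<close> are orthonormal for \<open>tau_inner\<close>, and this is the orthogonal
  projection onto their span.\<close>

definition pauli_expectation :: "real^3 \<Rightarrow> complex^2^2 \<Rightarrow> complex^2^2" where
  "pauli_expectation a X = mat (trace X / 2) + mscale (trace (pauli a ** X) / 2) (pauli a)"

lemma clinear_op_pauli_expectation: "clinear_op (pauli_expectation a)"
  unfolding clinear_op_def pauli_expectation_def
  by (auto simp: vec_eq_iff mat_def trace_add trace_mscale matrix_add_ldistrib
      mscale_mult_right add_divide_distrib distrib_left distrib_right)

text \<open>Left multiplication by the involution \<open>pauli a\<close> swaps the two coefficients.
  By cyclicity of the trace, right multiplication has the same effect.\<close>

lemma pauli_expectation_mult:
  assumes a: "norm a = 1"
  shows "pauli_expectation a (pauli a ** X) = pauli a ** pauli_expectation a X"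
    and "pauli_expectation a (X ** pauli a) = pauli_expectation a X ** pauli a"
proof -
  have UU: "pauli a ** (pauli a ** X) = X" for X
    by (simp add: matrix_mul_assoc pauli_square[OF a])
  show *: "pauli_expectation a (pauli a ** X) = pauli a ** pauli_expectation a X"
    by (simp add: pauli_expectation_def UU matrix_add_ldistrib mat_mult mscale_mult_right
        pauli_square[OF a] mat_eq_mscale[of "_ / _"] add.commute)
  have "trace (pauli a ** (X ** pauli a)) = trace X"
    by (subst trace_mul_sym) (simp add: pauli_square[OF a] flip: matrix_mul_assoc)
  then have "pauli_expectation a (X ** pauli a) = pauli_expectation a (pauli a ** X)"
    by (simp add: pauli_expectation_def UU trace_mul_sym[of X])
  also have "\<dots> = pauli_expectation a X ** pauli a"
    unfolding * by (simp add: pauli_expectation_def matrix_add_ldistrib matrix_add_rdistrib mat_mult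
        mscale_mult_right mscale_mult_left)
  finally show "pauli_expectation a (X ** pauli a) = pauli_expectation a X ** pauli a" .
qed

lemma pauli_expectation_bimodule:
  assumes a: "norm a = 1" and c: "c \<in> pauli_algebra a" and d: "d \<in> pauli_algebra a"
  shows "pauli_expectation a (c ** X ** d) = c ** pauli_expectation a X ** d"
proof -
  note lin = clinear_op_pauli_expectation[of a, unfolded clinear_op_def]
  have left: "pauli_expectation a (c ** X) = c ** pauli_expectation a X" for X
    using c lin by (auto simp: pauli_algebra_def matrix_add_rdistrib mat_mult mscale_mult_left
        pauli_expectation_mult[OF a])
  have right: "pauli_expectation a (X ** d) = pauli_expectation a X ** d" for X
    using d lin by (auto simp: pauli_algebra_def matrix_add_ldistrib mat_mult mscale_mult_right
        pauli_expectation_mult[OF a])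
  show ?thesis by (simp add: left right)
qed

lemma mstar_mult: "mstar (X ** Y) = mstar Y ** mstar X"
  by (simp add: vec_eq_iff matrix_matrix_mult_def mult.commute)

lemma mstar_add: "mstar (X + Y) = mstar X + mstar Y"
  by (simp add: vec_eq_iff)

lemma mstar_mscale: "mstar (mscale c X) = mscale (cnj c) (mstar X)"
  by (simp add: vec_eq_iff)

lemma mstar_mat: "mstar (mat c) = mat (cnj c)"
  by (simp add: vec_eq_iff mat_def)

lemma trace_mstar_mult_self_nonneg:
  obtains r where "r \<ge> 0" and "trace (mstar X ** X) = of_real r"
  by (rule that[OF _ trace_mstar_mult_self]) (auto intro!: sum_nonneg)

text \<open>\<open>mat 1 + pauli a\<close> is self-adjoint and its square is twice itself, so
  cyclicity turns the sum into half of \<open>trace (mstar Z ** Z)\<close> with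
  \<open>Z = X ** (mat 1 + pauli a)\<close>.\<close>

lemma trace_mult_mstar_mult_self_nonneg:
  assumes a: "norm a = 1"
  obtains r where "r \<ge> 0" and "trace (mstar X ** X) + trace (pauli a ** (mstar X ** X)) = of_real r"
proof -
  let ?P = "mat 1 + pauli a"
  obtain r where r: "r \<ge> 0" "trace (mstar (X ** ?P) ** (X ** ?P)) = of_real r"
    by (rule trace_mstar_mult_self_nonneg)
  have P: "mstar ?P = ?P" by (simp add: mstar_add mstar_mat)
  have PP: "?P ** ?P = mscale 2 ?P"
    by (simp add: matrix_add_ldistrib matrix_add_rdistrib pauli_square[OF a])
       (simp add: vec_eq_iff)
  have "trace (mstar (X ** ?P) ** (X ** ?P)) = trace (?P ** ?P ** (mstar X ** X))"
    unfolding mstar_mult P by (metis matrix_mul_assoc trace_mul_sym)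
  also have "\<dots> = 2 * (trace (mstar X ** X) + trace (pauli a ** (mstar X ** X)))"
    unfolding PP mscale_mult_left trace_mscale by (simp add: matrix_add_rdistrib trace_add)
  finally have "trace (mstar X ** X) + trace (pauli a ** (mstar X ** X)) = of_real (r / 2)"
    using r by simp
  then show ?thesis using r that[of "r / 2"] by simp
qed

lemma pauli_expectation_positive:
  assumes a: "norm a = 1"
  shows "\<exists>Y. pauli_expectation a (mstar X ** X) = mstar Y ** Y"
proof -
  let ?x = "trace (mstar X ** X)" and ?y = "trace (pauli a ** (mstar X ** X))"
  obtain r where r: "r \<ge> 0" "?x + ?y = of_real r"
    by (rule trace_mult_mstar_mult_self_nonneg[OF a])
  have m: "pauli (- a) = mscale (-1) (pauli a)"
    by (simp add: vec_eq_iff forall_2 complex_eq_iff)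
  \<comment> \<open>The vector \<open>- a\<close> reverses the sign of \<open>?y\<close>, which
    gives nonnegativity of the other eigenvalue.\<close>
  obtain s where s: "s \<ge> 0" "?x - ?y = of_real s"
    by (rule trace_mult_mstar_mult_self_nonneg[of "- a" X])
       (use a in \<open>auto simp: m mscale_mult_left trace_mscale\<close>)
  \<comment> \<open>\<open>p\<close> and \<open>q\<close> are the eigenvalues of the square root of the positive matrix \<open>(?x + ?y U) / 2\<close>.\<close>
  define p q where "p = sqrt (r / 2)" and "q = sqrt (s / 2)"
  have p2: "p * p = r / 2" and q2: "q * q = s / 2" using r s by (simp_all add: p_def q_def)
  have "complex_of_real (((p + q) / 2)\<^sup>2 + ((p - q) / 2)\<^sup>2) = of_real ((p * p + q * q) / 2)"
    by (simp add: power2_eq_square field_simps)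
  also have "\<dots> = ((?x + ?y) + (?x - ?y)) / 4"
    unfolding p2 q2 r s by (simp add: field_simps)
  finally have 1: "complex_of_real (((p + q) / 2)\<^sup>2 + ((p - q) / 2)\<^sup>2) = ?x / 2" by simp
  have "complex_of_real (2 * ((p + q) / 2) * ((p - q) / 2)) = of_real ((p * p - q * q) / 2)"
    by (simp add: field_simps)
  also have "\<dots> = ((?x + ?y) - (?x - ?y)) / 4"
    unfolding p2 q2 r s by (simp add: field_simps)
  finally have 2: "complex_of_real (2 * ((p + q) / 2) * ((p - q) / 2)) = ?y / 2" by simp
  \<comment> \<open>The root is sought inside the algebra: eigenvalues \<open>p\<close> and
    \<open>q\<close> force \<open>x\<close> and \<open>y\<close> to be their half sum and half
    difference.\<close>
  have "mstar Y ** Y = mat (of_real (x\<^sup>2 + y\<^sup>2)) + mscale (of_real (2 * x * y)) (pauli a)"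
    if "Y = mat (of_real x) + mscale (of_real y) (pauli a)" for Y x y
    unfolding that mstar_add mstar_mscale mstar_mat mstar_pauli complex_cnj_complex_of_real
      matrix_add_ldistrib matrix_add_rdistrib mat_mult mscale_mult_left mscale_mult_right
      pauli_square[OF a]
    by (simp add: vec_eq_iff mat_def power2_eq_square algebra_simps)
  from this[OF refl, of "(p + q) / 2" "(p - q) / 2"]
  show ?thesis unfolding 1 2 pauli_expectation_def by metis
qed

text \<open>Conditional expectations are unique, so it suffices that the orthogonal projection
  satisfies \<open>tp_cond_exp\<close>.\<close>

lemma jones_proj_pauli_algebra:
  assumes C: "unital_cstar_subalgebra (pauli_algebra a)" and a: "norm a = 1"
  shows "jones_proj (pauli_algebra a) = pauli_expectation a"
proof (rule jones_proj_eqI[OF C])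
  have "range (pauli_expectation a) \<subseteq> pauli_algebra a"
    by (auto simp: pauli_expectation_def pauli_algebra_def)
  moreover have "pauli_expectation a c = c" if "c \<in> pauli_algebra a" for c
    using that by (auto simp: pauli_algebra_def pauli_expectation_def trace_add trace_mscale trace_mat
        matrix_add_ldistrib mat_mult mscale_mult_right pauli_square[OF a])
  moreover have "trace (pauli_expectation a X) = trace X" for X
    by (simp add: pauli_expectation_def trace_add trace_mat trace_mscale)
  ultimately show "tp_cond_exp (pauli_algebra a) (pauli_expectation a)"
    unfolding tp_cond_exp_def
    using clinear_op_pauli_expectation pauli_expectation_positive[OF a] pauli_expectation_bimodule[OF a]
    by blast
qed

lemma jones_proj_pauli_algebra_minus_e1:
  assumes "unital_cstar_subalgebra (pauli_algebra a)" and "norm a = 1"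
  shows "(\<lambda>X. jones_proj (pauli_algebra a) X - jones_e1 X) = e1_op (pauli a) (pauli a)"
  unfolding jones_proj_pauli_algebra[OF assms]
  by (simp add: fun_eq_iff pauli_expectation_def jones_e1_eq e1_op_eq)

section \<open>The interior angle\<close>

text \<open>\<open>e1_op x y\<close> maps \<open>X\<close> to \<open>x\<close> times
  \<open>tau_inner (mstar y) X\<close>, so the adjoint exchanges the vectors \<open>x\<close> and
  \<open>mstar y\<close>.\<close>

lemma op_adjoint_e1_op: "op_adjoint (e1_op x y) = e1_op (mstar y) (mstar x)"
proof
  fix Y
  show "op_adjoint (e1_op x y) Y = e1_op (mstar y) (mstar x) Y"
  proof (rule tau_inner_eqD)
    fix X
    have "cnj (trace Z) = trace (mstar Z)" for Z :: "complex^'a^'a"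
      by (simp add: trace_def)
    then show "tau_inner X (op_adjoint (e1_op x y) Y) = tau_inner X (e1_op (mstar y) (mstar x) Y)"
      unfolding op_adjoint_tau_inner[OF clinear_op_e1_op, symmetric]
      by (simp add: tau_inner_def e1_op_eq mstar_mscale mscale_mult_left mscale_mult_right
          trace_mscale mstar_mult)
  qed
qed

text \<open>Composing the two operators leaves \<open>e1_op (mstar y) y'\<close> times
  \<open>tau_inner x x'\<close>, which supplies one factor \<open>1/n\<close>; the dual conditional
  expectation supplies the other two.\<close>

lemma op_inner_e1_op:
  "op_inner (e1_op x y) (e1_op x' y') =
     mscale (trace (mstar x ** x') / of_nat (CARD('n) ^ 3)) (mstar y ** y')"
  for x y x' y' :: "complex^'n^'n"
proof -
  let ?n = "of_nat CARD('n) :: complex"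
  have "op_adjoint (e1_op x y) \<circ> e1_op x' y' =
      (\<lambda>X. mscale (trace (mstar x ** x') / ?n) (e1_op (mstar y) y' X))"
    by (simp add: fun_eq_iff op_adjoint_e1_op e1_op_eq mscale_mult_right trace_mscale)
       (simp add: vec_eq_iff)
  moreover have "dual_cond_exp (e1_op (mstar y) y') = mscale (1 / of_nat (CARD('n)\<^sup>2)) (mstar y ** y')"
    using is_dual_cond_exp_dual_cond_exp unfolding is_dual_cond_exp_def e1_op_def by blast
  moreover have "dual_cond_exp (\<lambda>X. mscale c (e1_op (mstar y) y' X)) =
      mscale c (dual_cond_exp (e1_op (mstar y) y'))" for c
    using is_dual_cond_exp_dual_cond_exp clinear_op_e1_op unfolding is_dual_cond_exp_def by blast
  ultimately show ?thesis
    by (simp add: op_inner_def power3_eq_cube power2_eq_square mult.assoc)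
qed

lemma op_inner_e1_op_pauli:
  "op_inner (e1_op (pauli a) (pauli a)) (e1_op (pauli b) (pauli b)) =
     mscale (of_real (a \<bullet> b) / 4) (pauli a ** pauli b)"
  unfolding op_inner_e1_op mstar_pauli
  \<comment> \<open>The trace of the product is \<open>2 * (a \<bullet> b)\<close>, and 2 divided by
    the cube of 2 is 1/4.\<close>
  by (simp add: pauli_mult[of a b] trace_add trace_mat trace_mscale)

lemma opnorm_mscale_pauli_mult:
  "opnorm (mscale c (pauli a ** pauli b)) = cmod c * norm a * norm b"
  by (rule opnorm_eqI)
     (simp add: mscale_mult_vec norm_smult norm_pauli_mult_vec flip: matrix_vector_mul_assoc)

lemma cos_interior_angle_pauli_algebra:
  assumes "unital_cstar_subalgebra (pauli_algebra a)" and "norm a = 1"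
    and "unital_cstar_subalgebra (pauli_algebra b)" and "norm b = 1"
  shows "cos_interior_angle (pauli_algebra a) (pauli_algebra b) = \<bar>a \<bullet> b\<bar>"
proof -
  \<comment> \<open>The case of equal vectors has operator norm 1/4. The product of two such norms
    1/2 then cancels the 1/4 in the numerator.\<close>
  have half: "tilde_norm (e1_op (pauli u) (pauli u)) = 1 / 2" if "norm u = 1" for u
    unfolding tilde_norm_def op_inner_def[symmetric] op_inner_e1_op_pauli opnorm_mscale_pauli_mult
    using that by (simp add: dot_square_norm real_sqrt_divide)
  show ?thesis
    using assms by (simp add: half cos_interior_angle_def jones_proj_pauli_algebra_minus_e1
        op_inner_e1_op_pauli opnorm_mscale_pauli_mult)
qed

text \<open>Nonnegativity of the cosine puts its arccosine into \<open>{0..pi/2}\<close>, where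
  \<open>cos\<close> is injective.\<close>

lemma interior_angle_eq_arccos:
  assumes "0 \<le> cos_interior_angle C D" and "cos_interior_angle C D \<le> 1"
  shows "interior_angle C D = arccos (cos_interior_angle C D)"
  unfolding interior_angle_def
proof (rule the_equality)
  show "arccos (cos_interior_angle C D) \<in> {0..pi/2} \<and> cos (arccos (cos_interior_angle C D)) = cos_interior_angle C D"
    using assms arccos_le_pi2[of "cos_interior_angle C D"] by (auto intro: arccos_lbound)
next
  fix a assume a: "a \<in> {0..pi/2} \<and> cos a = cos_interior_angle C D"
  then have "arccos (cos a) = a" by (intro arccos_cos) auto
  then show "a = arccos (cos_interior_angle C D)" using a by simp
qed

theorem theoremA:
  fixes A B :: "(complex^2^2) set"
  assumes "unital_cstar_subalgebra A" and "scalar_matrices \<subset> A" and "A \<subset> UNIV"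
    and "unital_cstar_subalgebra B" and "scalar_matrices \<subset> B" and "B \<subset> UNIV"
  shows "dKK A B = sin (interior_angle A B)"
proof -
  obtain a where a: "norm a = 1" "A = pauli_algebra a"
    using assms(1-3) by (rule proper_unital_cstar_subalgebra_eq_pauli_algebra)
  obtain b where b: "norm b = 1" "B = pauli_algebra b"
    using assms(4-6) by (rule proper_unital_cstar_subalgebra_eq_pauli_algebra)
  have cos: "cos_interior_angle A B = \<bar>a \<bullet> b\<bar>"
    using assms(1,4) a b by (simp add: cos_interior_angle_pauli_algebra)
  have "interior_angle A B = arccos \<bar>a \<bullet> b\<bar>"
    using interior_angle_eq_arccos[of A B] abs_inner_unit_le_one[OF a(1) b(1)] cos by simp
  moreover have "sin (arccos \<bar>a \<bullet> b\<bar>) = sqrt (1 - \<bar>a \<bullet> b\<bar>\<^sup>2)"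
    using abs_inner_unit_le_one[OF a(1) b(1)] by (intro sin_arccos) auto
  ultimately show ?thesis
    using a b by (simp add: dKK_pauli_algebra)
qed

end
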